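(* Let $\Omega\subset\mathbb R^d$ be a bounded Lipschitz domain, let $g:[0,\infty)\to[0,\infty)$ be continuous and strictly increasing with $g(0)=0$, and let $P:\mathbb R\to[0,\infty)$ be continuous with $[t-1]^+\le P(t)\le[t]^+$ for all $t\in\mathbb R$ and $P(t)>0$ for all $t>0$. Let $\varrho,l,L>0$, $C>0$ and $\beta>d-1$. Then there exists a constant $\tilde\varepsilon>0$ depending only on $\beta,C,d,\Omega,\varrho,l,L,P$ and $g$ such that for all $0<\varepsilon<\tilde\varepsilon$ and all $y\in C^0(\partial\Omega;\mathbb R^d)$ satisfying $$l|x_1-x_2|\le|y(x_1)-y(x_2)|\le L|x_1-x_2|\quad\text{for all }x_1,x_2\in\partial\Omega\text{ with }|x_1-x_2|<\varrho,$$ the bound $E^{\partial\Omega}_\varepsilon(y)\le C$ implies that $y|_{\partial\Omega}$ is injective.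
   Context: $[a]^+:=\max\{0,a\}$, and $\mathcal H^{d-1}$ is the $(d-1)$-dimensional Hausdorff measure. For $\varepsilon>0$, $$E^{\partial\Omega}_\varepsilon(y):=\frac1{\varepsilon^\beta}\int_{\partial\Omega}\int_{\partial\Omega}\frac1{\varepsilon^{d-1}}P\Big(g(|\tilde x-x|)-g\Big(\frac{|y(\tilde x)-y(x)|}{\varepsilon}\Big)\Big)\,d\mathcal H^{d-1}(\tilde x)\,d\mathcal H^{d-1}(x).$$ *)

theory Defs
  imports "HOL-Analysis.Analysis"
begin

section \<open>Hausdorff measure\<close>

text \<open>
  The weight \<open>\<omega>\<^sub>s (diam E / 2)\<^sup>s\<close> of a covering set, with \<open>\<omega>\<^sub>s\<close> the volume of the \<open>s\<close>-dimensional
  unit ball. The empty set is singled out because \<open>0 ^ 0 = 1\<close>: nonempty sets must have weight at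
  least \<open>1\<close> for \<open>s = 0\<close> (counting measure), the empty set must not.
\<close>

definition hausdorff_weight :: "nat \<Rightarrow> 'a::metric_space set \<Rightarrow> ennreal" where
  "hausdorff_weight s E =
     (if E = {} then 0 else ennreal (unit_ball_vol (real s) * (diameter E / 2) ^ s))"

text \<open>Boundedness is demanded explicitly because \<^const>\<open>diameter\<close> is unspecified on unbounded sets.\<close>

definition hausdorff_covers :: "real \<Rightarrow> 'a::metric_space set \<Rightarrow> (nat \<Rightarrow> 'a set) set" where
  "hausdorff_covers \<delta> A =
     {E. A \<subseteq> (\<Union>i. E i) \<and> (\<forall>i. bounded (E i) \<and> diameter (E i) \<le> \<delta>)}"

definition hausdorff_premeasure :: "nat \<Rightarrow> real \<Rightarrow> 'a::metric_space set \<Rightarrow> ennreal" where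
  "hausdorff_premeasure s \<delta> A = (INF E \<in> hausdorff_covers \<delta> A. \<Sum>i. hausdorff_weight s (E i))"

definition hausdorff_outer_measure :: "nat \<Rightarrow> 'a::metric_space set \<Rightarrow> ennreal" where
  "hausdorff_outer_measure s A = (SUP \<delta> \<in> {0<..}. hausdorff_premeasure s \<delta> A)"

definition hausdorff_measure :: "nat \<Rightarrow> 'a::metric_space measure" where
  "hausdorff_measure s = measure_of UNIV (sets borel) (hausdorff_outer_measure s)"

text \<open>
  Since \<^const>\<open>measure_of\<close> yields the zero measure if its argument is not countably additive, the
  following shows that the Hausdorff outer measure is a metric outer measure, hence countably
  additive on the Borel sets (lemma \<open>emeasure_hausdorff_measure\<close>).
\<close>

lemma hausdorff_weight_empty [simp]: "hausdorff_weight s {} = 0"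
  by (simp add: hausdorff_weight_def)

lemma hausdorff_premeasure_mono:
  assumes "A \<subseteq> B"
  shows "hausdorff_premeasure s \<delta> A \<le> hausdorff_premeasure s \<delta> B"
  unfolding hausdorff_premeasure_def
  by (rule INF_superset_mono) (use assms in \<open>auto simp: hausdorff_covers_def\<close>)

lemma hausdorff_premeasure_antimono:
  assumes "\<delta> \<le> \<delta>'"
  shows "hausdorff_premeasure s \<delta>' A \<le> hausdorff_premeasure s \<delta> A"
  unfolding hausdorff_premeasure_def
  by (rule INF_superset_mono) (use assms in \<open>auto simp: hausdorff_covers_def intro: order_trans\<close>)

lemma hausdorff_premeasure_le:
  "E \<in> hausdorff_covers \<delta> A \<Longrightarrow> hausdorff_premeasure s \<delta> A \<le> (\<Sum>i. hausdorff_weight s (E i))"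
  unfolding hausdorff_premeasure_def by (rule INF_lower)

lemma hausdorff_premeasure_empty [simp]:
  assumes "\<delta> > 0"
  shows "hausdorff_premeasure s \<delta> {} = 0"
proof -
  have "(\<lambda>_. {}) \<in> hausdorff_covers \<delta> {}"
    using assms by (auto simp: hausdorff_covers_def)
  from hausdorff_premeasure_le[OF this, of s] show ?thesis
    by simp
qed

lemma hausdorff_premeasure_UN:
  "hausdorff_premeasure s \<delta> (\<Union>i. A i) \<le> (\<Sum>i. hausdorff_premeasure s \<delta> (A i))"
proof (rule ennreal_le_epsilon)
  fix e :: real
  assume fin: "(\<Sum>i. hausdorff_premeasure s \<delta> (A i)) < top" and e: "0 < e"
  have fin_i: "hausdorff_premeasure s \<delta> (A i) \<noteq> top" for i
  proof
    assume "hausdorff_premeasure s \<delta> (A i) = top"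
    moreover have "hausdorff_premeasure s \<delta> (A i) \<le> (\<Sum>i. hausdorff_premeasure s \<delta> (A i))"
      using sum_le_suminf[of "\<lambda>i. hausdorff_premeasure s \<delta> (A i)" "{i}"] by simp
    ultimately show False
      using fin by (simp add: top_unique)
  qed
  have "\<exists>E. E \<in> hausdorff_covers \<delta> (A i) \<and>
      (\<Sum>j. hausdorff_weight s (E j)) \<le> hausdorff_premeasure s \<delta> (A i) + ennreal (e * (1/2) ^ Suc i)"
    for i
  proof -
    have "0 < ennreal (e * (1/2) ^ Suc i)"
      using e by (intro ennreal_less_zero_iff[THEN iffD2] mult_pos_pos zero_less_power) auto
    then have "hausdorff_premeasure s \<delta> (A i) + 0 < hausdorff_premeasure s \<delta> (A i) + ennreal (e * (1/2) ^ Suc i)"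
      using fin_i[of i] by (intro ennreal_add_left_cancel_less[THEN iffD2]) simp
    then have "hausdorff_premeasure s \<delta> (A i) < hausdorff_premeasure s \<delta> (A i) + ennreal (e * (1/2) ^ Suc i)"
      by simp
    then obtain E where "E \<in> hausdorff_covers \<delta> (A i)"
      "(\<Sum>j. hausdorff_weight s (E j)) < hausdorff_premeasure s \<delta> (A i) + ennreal (e * (1/2) ^ Suc i)"
      unfolding hausdorff_premeasure_def INF_less_iff by blast
    then show ?thesis
      by (auto intro: less_imp_le)
  qed
  then obtain E where E: "\<And>i. E i \<in> hausdorff_covers \<delta> (A i)"
    and le: "\<And>i. (\<Sum>j. hausdorff_weight s (E i j))
                   \<le> hausdorff_premeasure s \<delta> (A i) + ennreal (e * (1/2) ^ Suc i)"
    by metis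
  define F where "F k = case_prod E (prod_decode k)" for k
  have "F \<in> hausdorff_covers \<delta> (\<Union>i. A i)"
    unfolding hausdorff_covers_def mem_Collect_eq
  proof (intro conjI subsetI allI)
    fix x assume "x \<in> (\<Union>i. A i)"
    then obtain i where "x \<in> A i" by blast
    with E[of i] obtain j where "x \<in> E i j"
      by (auto simp: hausdorff_covers_def)
    then show "x \<in> (\<Union>k. F k)"
      by (auto simp: F_def intro!: exI[of _ "prod_encode (i, j)"])
  next
    fix k
    show "bounded (F k)" "diameter (F k) \<le> \<delta>"
      using E by (auto simp: F_def hausdorff_covers_def split: prod.split)
  qed
  from hausdorff_premeasure_le[OF this, of s]
  have "hausdorff_premeasure s \<delta> (\<Union>i. A i) \<le> (\<Sum>k. hausdorff_weight s (F k))" .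
  also have "\<dots> = (\<Sum>k. (\<lambda>p. hausdorff_weight s (case_prod E p)) (prod_decode k))"
    by (simp add: F_def)
  also have "\<dots> = (\<Sum>i. \<Sum>j. hausdorff_weight s (E i j))"
    by (rule suminf_ennreal_2dimen) simp
  also have "\<dots> \<le> (\<Sum>i. hausdorff_premeasure s \<delta> (A i) + ennreal (e * (1/2) ^ Suc i))"
    by (intro suminf_le le) auto
  also have "\<dots> = (\<Sum>i. hausdorff_premeasure s \<delta> (A i)) + (\<Sum>i. ennreal (e * (1/2) ^ Suc i))"
    by (rule suminf_add[symmetric]) auto
  also have "(\<Sum>i. ennreal (e * (1/2) ^ Suc i)) = ennreal e"
    using e by (intro suminf_ennreal_eq) (auto intro: sums_mult[OF power_half_series, of e, simplified])
  finally show "hausdorff_premeasure s \<delta> (\<Union>i. A i) \<le> (\<Sum>i. hausdorff_premeasure s \<delta> (A i)) + ennreal e" .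
qed

lemma hausdorff_premeasure_separated:
  assumes sep: "\<And>a b. a \<in> A \<Longrightarrow> b \<in> B \<Longrightarrow> \<delta> < dist a b"
  shows "hausdorff_premeasure s \<delta> A + hausdorff_premeasure s \<delta> B \<le> hausdorff_premeasure s \<delta> (A \<union> B)"
  unfolding hausdorff_premeasure_def[of s \<delta> "A \<union> B"]
proof (rule INF_greatest)
  fix E assume "E \<in> hausdorff_covers \<delta> (A \<union> B)"
  then have cov: "A \<union> B \<subseteq> (\<Union>i. E i)" and E: "\<And>i. bounded (E i)" "\<And>i. diameter (E i) \<le> \<delta>"
    by (auto simp: hausdorff_covers_def)
  show "hausdorff_premeasure s \<delta> A + hausdorff_premeasure s \<delta> B \<le> (\<Sum>i. hausdorff_weight s (E i))"
  proof (cases "\<delta> < 0")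
    case True
    then show ?thesis
      using E(1)[of undefined] E(2)[of undefined] diameter_ge_0[of "E undefined"] by linarith
  next
    case False
    define F where "F i = (if E i \<inter> A = {} then {} else E i)" for i
    define G where "G i = (if E i \<inter> B = {} then {} else E i)" for i
    have "F \<in> hausdorff_covers \<delta> A" "G \<in> hausdorff_covers \<delta> B"
      using cov E False unfolding hausdorff_covers_def F_def G_def by fastforce+
    then have "hausdorff_premeasure s \<delta> A + hausdorff_premeasure s \<delta> B
        \<le> (\<Sum>i. hausdorff_weight s (F i)) + (\<Sum>i. hausdorff_weight s (G i))"
      by (intro add_mono hausdorff_premeasure_le)
    also have "\<dots> = (\<Sum>i. hausdorff_weight s (F i) + hausdorff_weight s (G i))"
      by (rule suminf_add) auto
    also have "\<dots> \<le> (\<Sum>i. hausdorff_weight s (E i))"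
    proof (intro suminf_le)
      fix i
      have "E i \<inter> A = {} \<or> E i \<inter> B = {}"
      proof (rule ccontr)
        assume "\<not> ?thesis"
        then obtain a b where ab: "a \<in> E i" "a \<in> A" "b \<in> E i" "b \<in> B" by blast
        then have "dist a b \<le> \<delta>"
          using diameter_bounded_bound[OF E(1)[of i], of a b] E(2)[of i] by linarith
        with sep[of a b] ab show False by simp
      qed
      then show "hausdorff_weight s (F i) + hausdorff_weight s (G i) \<le> hausdorff_weight s (E i)"
        by (auto simp: F_def G_def)
    qed auto
    finally show ?thesis .
  qed
qed

lemma hausdorff_premeasure_le_outer:
  "\<delta> > 0 \<Longrightarrow> hausdorff_premeasure s \<delta> A \<le> hausdorff_outer_measure s A"
  unfolding hausdorff_outer_measure_def by (rule SUP_upper) simp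

lemma hausdorff_outer_measure_mono:
  "A \<subseteq> B \<Longrightarrow> hausdorff_outer_measure s A \<le> hausdorff_outer_measure s B"
  unfolding hausdorff_outer_measure_def by (intro SUP_mono' hausdorff_premeasure_mono)

lemma hausdorff_outer_measure_empty [simp]: "hausdorff_outer_measure s {} = 0"
  unfolding hausdorff_outer_measure_def by (simp cong: SUP_cong_simp)

lemma hausdorff_outer_measure_UN:
  "hausdorff_outer_measure s (\<Union>i. A i) \<le> (\<Sum>i. hausdorff_outer_measure s (A i))"
  unfolding hausdorff_outer_measure_def[of s "\<Union>i. A i"]
proof (rule SUP_least)
  fix \<delta> :: real assume "\<delta> \<in> {0<..}"
  then have "(\<Sum>i. hausdorff_premeasure s \<delta> (A i)) \<le> (\<Sum>i. hausdorff_outer_measure s (A i))"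
    by (intro suminf_le hausdorff_premeasure_le_outer) auto
  then show "hausdorff_premeasure s \<delta> (\<Union>i. A i) \<le> (\<Sum>i. hausdorff_outer_measure s (A i))"
    using hausdorff_premeasure_UN order_trans by blast
qed

lemma hausdorff_outer_measure_Un:
  "hausdorff_outer_measure s (A \<union> B) \<le> hausdorff_outer_measure s A + hausdorff_outer_measure s B"
proof -
  define F where "F = (\<lambda>i::nat. if i = 0 then A else if i = 1 then B else {})"
  have "A \<union> B = (\<Union>i. F i)"
    by (auto simp: F_def split: if_splits)
  moreover have "(\<Sum>i. hausdorff_outer_measure s (F i)) = (\<Sum>i\<in>{0,1}. hausdorff_outer_measure s (F i))"
    by (rule suminf_finite) (auto simp: F_def)
  ultimately show ?thesis
    using hausdorff_outer_measure_UN[of s F] by (simp add: F_def)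
qed

lemma hausdorff_outer_measure_separated:
  assumes "r > 0" and sep: "\<And>a b. a \<in> A \<Longrightarrow> b \<in> B \<Longrightarrow> r \<le> dist a b"
  shows "hausdorff_outer_measure s (A \<union> B) = hausdorff_outer_measure s A + hausdorff_outer_measure s B"
proof (rule antisym[OF hausdorff_outer_measure_Un])
  have le: "hausdorff_premeasure s \<delta> A + hausdorff_premeasure s \<delta>' B \<le> hausdorff_outer_measure s (A \<union> B)"
    if "\<delta> > 0" "\<delta>' > 0" for \<delta> \<delta>'
  proof -
    define \<eta> where "\<eta> = min (r / 2) (min \<delta> \<delta>')"
    have \<eta>: "\<eta> > 0" "\<eta> < r" "\<eta> \<le> \<delta>" "\<eta> \<le> \<delta>'"
      using that \<open>r > 0\<close> by (auto simp: \<eta>_def)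
    have "hausdorff_premeasure s \<delta> A + hausdorff_premeasure s \<delta>' B
        \<le> hausdorff_premeasure s \<eta> A + hausdorff_premeasure s \<eta> B"
      by (intro add_mono hausdorff_premeasure_antimono \<eta>)
    also have "\<dots> \<le> hausdorff_premeasure s \<eta> (A \<union> B)"
      using sep \<eta>(2) by (intro hausdorff_premeasure_separated) (metis less_le_trans)
    also have "\<dots> \<le> hausdorff_outer_measure s (A \<union> B)"
      by (rule hausdorff_premeasure_le_outer[OF \<eta>(1)])
    finally show ?thesis .
  qed
  have le': "hausdorff_premeasure s \<delta> A + hausdorff_outer_measure s B \<le> hausdorff_outer_measure s (A \<union> B)"
    if "\<delta> > 0" for \<delta>
    unfolding hausdorff_outer_measure_def[of s B]
    by (subst ennreal_SUP_add_right) (auto intro!: SUP_least le that)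
  show "hausdorff_outer_measure s A + hausdorff_outer_measure s B \<le> hausdorff_outer_measure s (A \<union> B)"
    unfolding hausdorff_outer_measure_def[of s A]
    by (subst ennreal_SUP_add_left[symmetric]) (auto intro!: SUP_least le')
qed

lemma hausdorff_outer_measure_UN_separated:
  fixes n :: nat and R :: "nat \<Rightarrow> 'a::metric_space set"
  assumes "\<And>j k. j < k \<Longrightarrow> \<exists>r>0. \<forall>a\<in>R j. \<forall>b\<in>R k. r \<le> dist a b"
  shows "(\<Sum>k<n. hausdorff_outer_measure s (R k)) = hausdorff_outer_measure s (\<Union>k<n. R k)"
proof (induction n)
  case (Suc n)
  have "\<forall>j. \<exists>r. j < n \<longrightarrow> r > 0 \<and> (\<forall>a\<in>R j. \<forall>b\<in>R n. r \<le> dist a b)"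
    using assms by blast
  then obtain r where r: "\<And>j. j < n \<Longrightarrow> r j > 0 \<and> (\<forall>a\<in>R j. \<forall>b\<in>R n. r j \<le> dist a b)"
    by metis
  define \<rho> where "\<rho> = Min (insert 1 (r ` {..<n}))"
  have "\<rho> > 0"
    using r by (simp add: \<rho>_def)
  moreover have "\<rho> \<le> dist a b" if "a \<in> (\<Union>k<n. R k)" "b \<in> R n" for a b
  proof -
    from that obtain j where j: "j < n" "a \<in> R j" by blast
    then have "\<rho> \<le> r j" unfolding \<rho>_def by (intro Min_le) auto
    with r j that show ?thesis by force
  qed
  ultimately have "hausdorff_outer_measure s ((\<Union>k<n. R k) \<union> R n)
      = hausdorff_outer_measure s (\<Union>k<n. R k) + hausdorff_outer_measure s (R n)"
    by (rule hausdorff_outer_measure_separated)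
  with Suc show ?case
    by (simp add: lessThan_Suc Un_commute)
qed simp

lemma hausdorff_outer_measure_closed_split:
  fixes A C :: "'a::metric_space set"
  assumes C: "closed C"
  shows "hausdorff_outer_measure s (A \<inter> C) + hausdorff_outer_measure s (A - C)
           \<le> hausdorff_outer_measure s A" (is "?H (A \<inter> C) + _ \<le> _")
proof (cases "C = {} \<or> ?H A = top")
  case True
  then show ?thesis by auto
next
  case False
  then have ne: "C \<noteq> {}" and fin: "?H A \<noteq> top" by auto
  define T where "T n = {x \<in> A. 1 / real (n + 1) \<le> infdist x C}" for n
  define R where "R k = {x \<in> A. 1 / real (k + 2) \<le> infdist x C \<and> infdist x C < 1 / real (k + 1)}" for k
  have dist_ge: "infdist a C - infdist b C \<le> dist a b" for a b
    using infdist_triangle[of a C b] by simp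
  have sepR: "\<exists>r>0. \<forall>a\<in>R j. \<forall>b\<in>R k. r \<le> dist a b" if "j + 2 \<le> k" for j k
  proof (intro exI conjI ballI)
    show "1 / real (j + 2) - 1 / real (j + 3) > 0"
      by (simp add: divide_strict_left_mono)
    fix a b assume ab: "a \<in> R j" "b \<in> R k"
    have "1 / real (k + 1) \<le> 1 / real (j + 3)"
      using that by (intro divide_left_mono) auto
    with ab dist_ge[of a b] show "1 / real (j + 2) - 1 / real (j + 3) \<le> dist a b"
      by (auto simp: R_def)
  qed
  have half: "(\<Sum>k<n. ?H (R (2 * k + i))) \<le> ?H A" for n i
  proof -
    have "(\<Sum>k<n. ?H (R (2 * k + i))) = ?H (\<Union>k<n. R (2 * k + i))"
      by (rule hausdorff_outer_measure_UN_separated[where R = "\<lambda>k. R (2 * k + i)"]) (rule sepR, simp)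
    also have "\<dots> \<le> ?H A"
      by (rule hausdorff_outer_measure_mono) (auto simp: R_def)
    finally show ?thesis .
  qed
  have "(\<Sum>k<n. ?H (R k)) \<le> ?H A + ?H A" for n
  proof -
    have "(\<Sum>k<n. ?H (R k)) \<le> (\<Sum>k<2*n. ?H (R k))"
      by (rule sum_mono2) auto
    also have "\<dots> = (\<Sum>k<n. ?H (R (2 * k + 0))) + (\<Sum>k<n. ?H (R (2 * k + 1)))"
      by (induction n) (simp_all add: algebra_simps)
    also have "\<dots> \<le> ?H A + ?H A"
      by (intro add_mono half)
    finally show ?thesis .
  qed
  then have "(\<Sum>k. ?H (R k)) \<le> ?H A + ?H A"
    by (intro suminf_le_const) auto
  then have finR: "(\<Sum>k. ?H (R k)) \<noteq> top"
    using fin by (auto simp: top_unique)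
  have "(\<Sum>k<n. ?H (R k)) + (?H (A \<inter> C) + ?H (A - C)) \<le> ?H A + (\<Sum>k. ?H (R k))" for n
  proof -
    have "A - C \<subseteq> T n \<union> (\<Union>k. R (k + n))"
    proof
      fix x assume x: "x \<in> A - C"
      then have pos: "infdist x C > 0"
        using infdist_pos_not_in_closed[OF C ne] by auto
      show "x \<in> T n \<union> (\<Union>k. R (k + n))"
      proof (cases "1 / real (n + 1) \<le> infdist x C")
        case True
        with x show ?thesis by (auto simp: T_def)
      next
        case False
        obtain m where m: "1 / real (m + 1) \<le> infdist x C"
          using reals_Archimedean[OF pos] by (auto simp: field_simps intro: less_imp_le)
        define l where "l = (LEAST m. 1 / real (m + 1) \<le> infdist x C)"
        have l: "1 / real (l + 1) \<le> infdist x C"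
          unfolding l_def by (rule LeastI[of _ m]) (rule m)
        have "n < l"
        proof (rule ccontr)
          assume "\<not> n < l"
          then have "1 / real (n + 1) \<le> 1 / real (l + 1)"
            by (intro divide_left_mono) auto
          with l False show False by linarith
        qed
        then obtain k where k: "l = Suc (k + n)"
          by (metis add.commute less_imp_Suc_add)
        have "\<not> 1 / real (k + n + 1) \<le> infdist x C"
          using k unfolding l_def by (intro not_less_Least) linarith
        with l k x have "x \<in> R (k + n)"
          by (auto simp: R_def algebra_simps)
        then show ?thesis by blast
      qed
    qed
    then have "?H (A - C) \<le> ?H (T n \<union> (\<Union>k. R (k + n)))"
      by (rule hausdorff_outer_measure_mono)
    also have "\<dots> \<le> ?H (T n) + (\<Sum>k. ?H (R (k + n)))"
      by (rule order_trans[OF hausdorff_outer_measure_Un])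
        (intro add_left_mono hausdorff_outer_measure_UN)
    finally have 1: "?H (A - C) \<le> ?H (T n) + (\<Sum>k. ?H (R (k + n)))" .
    have "1 / real (n + 1) \<le> dist a b" if "a \<in> A \<inter> C" "b \<in> T n" for a b
      using that dist_ge[of b a] by (auto simp: T_def dist_commute)
    then have "?H (A \<inter> C) + ?H (T n) = ?H ((A \<inter> C) \<union> T n)"
      by (intro hausdorff_outer_measure_separated[symmetric, of "1 / real (n + 1)"]) auto
    also have "\<dots> \<le> ?H A"
      by (rule hausdorff_outer_measure_mono) (auto simp: T_def)
    finally have 2: "?H (A \<inter> C) + ?H (T n) \<le> ?H A" .
    have "(\<Sum>k<n. ?H (R k)) + (?H (A \<inter> C) + ?H (A - C))
        \<le> (\<Sum>k<n. ?H (R k)) + (?H (A \<inter> C) + (?H (T n) + (\<Sum>k. ?H (R (k + n)))))"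
      by (intro add_left_mono 1)
    also have "\<dots> = (?H (A \<inter> C) + ?H (T n)) + ((\<Sum>k. ?H (R (k + n))) + (\<Sum>k<n. ?H (R k)))"
      by (simp add: ac_simps)
    also have "(\<Sum>k. ?H (R (k + n))) + (\<Sum>k<n. ?H (R k)) = (\<Sum>k. ?H (R k))"
      by (rule suminf_offset[symmetric]) auto
    finally show ?thesis
      using 2 by (meson add_right_mono order_trans)
  qed
  then have "(\<Sum>k. ?H (R k)) + (?H (A \<inter> C) + ?H (A - C)) \<le> ?H A + (\<Sum>k. ?H (R k))"
    by (intro ennreal_suminf_bound_add) auto
  then have "(\<Sum>k. ?H (R k)) + (?H (A \<inter> C) + ?H (A - C)) \<le> (\<Sum>k. ?H (R k)) + ?H A"
    by (simp add: add.commute)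
  then show ?thesis
    using finR by (simp add: ennreal_add_left_cancel_le)
qed

lemma measure_space_hausdorff:
  "measure_space UNIV (sets borel) (hausdorff_outer_measure s :: 'a::metric_space set \<Rightarrow> ennreal)"
proof -
  let ?H = "hausdorff_outer_measure s :: 'a set \<Rightarrow> ennreal"
  let ?L = "lambda_system UNIV (Pow UNIV) ?H"
  interpret P: sigma_algebra "UNIV :: 'a set" "Pow UNIV"
    by (rule sigma_algebra_Pow)
  have "outer_measure_space (Pow UNIV) ?H"
    unfolding outer_measure_space_def positive_def increasing_def countably_subadditive_def
    by (auto intro: hausdorff_outer_measure_mono hausdorff_outer_measure_UN)
  then have ms: "measure_space UNIV ?L ?H"
    by (rule P.caratheodory_lemma)
  then interpret L: sigma_algebra UNIV ?L
    by (simp add: measure_space_def)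
  have "C \<in> ?L" if "closed C" for C
  proof -
    have "?H (A \<inter> C) + ?H (A - C) = ?H A" for A
    proof (rule antisym[OF hausdorff_outer_measure_closed_split[OF that]])
      show "?H A \<le> ?H (A \<inter> C) + ?H (A - C)"
        using hausdorff_outer_measure_Un[of s "A \<inter> C" "A - C"] by (simp add: Int_Diff_Un)
    qed
    then show ?thesis
      unfolding P.lambda_system_eq by simp
  qed
  then have "sigma_sets UNIV (Collect closed) \<subseteq> ?L"
    by (intro L.sigma_sets_subset) auto
  then have "sets borel \<subseteq> ?L"
    by (simp add: borel_eq_closed)
  then show ?thesis
    using measure_down[OF ms _ ] sets.sigma_algebra_axioms[of "borel :: 'a measure"] by simp
qed

lemma space_hausdorff_measure [simp]: "space (hausdorff_measure s) = UNIV"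
  by (simp add: hausdorff_measure_def space_measure_of_conv)

lemma sets_hausdorff_measure [simp, measurable_cong]: "sets (hausdorff_measure s) = sets borel"
  unfolding hausdorff_measure_def
  by (metis sets.sets_measure_of_eq space_borel)

lemma emeasure_hausdorff_measure:
  "A \<in> sets borel \<Longrightarrow> emeasure (hausdorff_measure s) A = hausdorff_outer_measure s A"
  using measure_space_hausdorff[of s]
  by (intro emeasure_measure_of[OF hausdorff_measure_def]) (auto simp: measure_space_def)


section \<open>Bounded Lipschitz domains\<close>

text \<open>
  Near every boundary point the domain is, in suitable orthonormal coordinates, the strict epigraph
  of a Lipschitz function of the first \<open>d - 1\<close> coordinates. Here \<open>e\<close> is the unit vector of the last
  coordinate axis, and the span of the other axes is identified with the hyperplane \<open>e\<^sup>\<bottom>\<close>,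
  onto which \<open>x - (x \<bullet> e) e\<close> is the orthogonal projection of \<open>x\<close>.
\<close>

definition lipschitz_boundary :: "'a::euclidean_space set \<Rightarrow> bool" where
  "lipschitz_boundary \<Omega> \<longleftrightarrow>
     (\<forall>p \<in> frontier \<Omega>. \<exists>r > 0. \<exists>e \<gamma> K. norm e = 1 \<and> K-lipschitz_on {z. z \<bullet> e = 0} \<gamma> \<and>
        \<Omega> \<inter> ball p r = {x \<in> ball p r. \<gamma> (x - (x \<bullet> e) *\<^sub>R e) < x \<bullet> e})"

definition bounded_lipschitz_domain :: "'a::euclidean_space set \<Rightarrow> bool" where
  "bounded_lipschitz_domain \<Omega> \<longleftrightarrow>
     \<Omega> \<noteq> {} \<and> open \<Omega> \<and> connected \<Omega> \<and> bounded \<Omega> \<and> lipschitz_boundary \<Omega>"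


section \<open>The nonlocal self-repulsion energy on the boundary\<close>

text \<open>
  The integrand is nonnegative whenever \<open>P\<close> is, so the double integral is taken in \<^typ>\<open>ennreal\<close>
  and may be infinite.
\<close>

definition boundary_energy ::
    "(real \<Rightarrow> real) \<Rightarrow> (real \<Rightarrow> real) \<Rightarrow> real \<Rightarrow> (real ^ 'd) set \<Rightarrow> real \<Rightarrow>
     (real ^ 'd \<Rightarrow> real ^ 'd) \<Rightarrow> ennreal" where
  "boundary_energy P g \<beta> \<Omega> \<epsilon> y =
     ennreal (1 / \<epsilon> powr \<beta>) *
     (\<integral>\<^sup>+ x \<in> frontier \<Omega>. (\<integral>\<^sup>+ x' \<in> frontier \<Omega>.
        ennreal (1 / \<epsilon> ^ (CARD('d) - 1) * P (g (norm (x' - x)) - g (norm (y x' - y x) / \<epsilon>)))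
        \<partial>hausdorff_measure (CARD('d) - 1)) \<partial>hausdorff_measure (CARD('d) - 1))"

end

theory Submission
  imports Defs
begin

text \<open>
  Suppose that \<open>y a = y b\<close> for two distinct boundary points. The local lower bound on \<open>y\<close> forces
  \<open>norm (a - b) \<ge> \<rho>\<close>. For small \<open>\<epsilon>\<close>, on balls of radius \<open>c \<epsilon>\<close> about \<open>a\<close> and \<open>b\<close>, with
  \<open>c = \<rho> / (8 L)\<close>, the points \<open>x\<close> and \<open>x'\<close> stay at distance at least \<open>\<rho> / 2\<close> from
  each other, while the Lipschitz bound gives
  \<open>norm (y x' - y x) / \<epsilon> \<le> \<rho> / 4\<close>. So the argument of \<open>P\<close> is at least \<open>g (\<rho> / 2) - g (\<rho> / 4) > 0\<close>,
  and the integrand is at least a positive constant divided by \<open>\<epsilon>\<^sup>d\<^sup>-\<^sup>1\<close>. If each of the two balls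
  meets the boundary in a set of measure at least \<open>\<kappa> (c \<epsilon>)\<^sup>d\<^sup>-\<^sup>1\<close>, the energy is at least a constant
  times \<open>\<epsilon> powr (d - 1 - \<beta>)\<close>. Since \<open>\<beta> > d - 1\<close>, this exceeds \<open>C\<close> for small \<open>\<epsilon>\<close>
  (\<open>boundary_energy_ge\<close>).

  What has to be built is this lower bound on the measure of boundary pieces, uniformly in the
  centre (\<open>lipschitz_boundary_lower_density\<close>). Near a boundary point the boundary is a Lipschitz
  graph, so the projection of its part in a ball of radius \<open>r\<close> covers a cube in the hyperplane \<open>e\<^sup>\<bottom>\<close>
  whose side is proportional to \<open>r\<close>; compactness of the boundary makes the constants uniform.
  That a set whose projection covers a cube has at least the expected \<open>(d-1)\<close>-dimensional Hausdorff measure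
  is seen by comparison with Lebesgue measure in dimension \<open>d\<close>: a covering of the set by pieces of
  diameter \<open>D\<close> gives a covering of the slab of height \<open>1\<close> over the cube by slabs of height \<open>1\<close>
  and base side \<open>2 D\<close>, whose volumes are a fixed multiple of the Hausdorff weights
  (\<open>hausdorff_outer_measure_ge_cube_projection\<close>). For \<open>d = 1\<close> every slab is the unit interval and
  the comparison says that a covering of a nonempty set has a nonempty member.
\<close>

section \<open>Sets whose projection covers a cube\<close>

definition slab :: "'n::finite \<Rightarrow> real^'n \<Rightarrow> real \<Rightarrow> (real^'n) set" where
  "slab k c s = cbox (\<chi> j. if j = k then 0 else c $ j - s) (\<chi> j. if j = k then 1 else c $ j + s)"

lemma mem_slab_iff:
  "w \<in> slab k c s \<longleftrightarrow> (0 \<le> w $ k \<and> w $ k \<le> 1) \<and> (\<forall>j. j \<noteq> k \<longrightarrow> \<bar>w $ j - c $ j\<bar> \<le> s)"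
proof -
  have "w \<in> slab k c s \<longleftrightarrow> (\<forall>j. if j = k then 0 \<le> w $ j \<and> w $ j \<le> 1 else \<bar>w $ j - c $ j\<bar> \<le> s)"
    unfolding slab_def mem_box_cart by (intro all_cong1) auto
  then show ?thesis by metis
qed

lemma emeasure_slab:
  fixes c :: "real^'n::finite"
  assumes "0 \<le> s"
  shows "emeasure lborel (slab k c s) = ennreal ((2 * s) ^ (CARD('n) - 1))"
proof -
  have "(\<chi> j. if j = k then 0 else c $ j) \<in> slab k c s"
    using assms by (simp add: mem_slab_iff)
  then have "measure lborel (slab k c s) = (\<Prod>j\<in>UNIV. if j = k then 1 else 2 * s)"
    unfolding slab_def by (subst content_cbox_cart) (auto intro!: prod.cong)
  also have "\<dots> = (2 * s) ^ (CARD('n) - 1)"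
    by (subst prod.remove[of _ k]) (auto simp: card_Diff_singleton)
  finally have content: "measure lborel (slab k c s) = (2 * s) ^ (CARD('n) - 1)" .
  have "emeasure lborel (slab k c s) \<noteq> top"
    unfolding slab_def using emeasure_lborel_cbox_finite by (simp add: less_top)
  from emeasure_eq_ennreal_measure[OF this] show ?thesis
    by (simp only: content)
qed

text \<open>
  The map \<open>h\<close> only has to be nonexpansive in each coordinate other than \<open>k\<close>; the hypothesis on \<open>A\<close>
  says that in these coordinates \<open>h ` A\<close> covers the cube of centre \<open>c\<close> and half side \<open>s\<close>.
  A covering set of diameter \<open>D\<close> is replaced by a slab of half side \<open>D\<close>, with volume \<open>(2 D)\<^sup>d\<^sup>-\<^sup>1\<close>,
  while its weight contains \<open>(D / 2)\<^sup>d\<^sup>-\<^sup>1\<close>; this factor \<open>4\<close> per dimension is why the conclusion has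
  \<open>s / 2\<close> where the cube has side \<open>2 s\<close>.
\<close>

lemma hausdorff_outer_measure_ge_cube_projection:
  fixes A :: "'a::metric_space set" and h :: "'a \<Rightarrow> real^'n::finite"
  assumes s: "0 \<le> s"
    and h: "\<And>x x' j. j \<noteq> k \<Longrightarrow> \<bar>h x $ j - h x' $ j\<bar> \<le> dist x x'"
    and cube: "\<And>w. (\<And>j. j \<noteq> k \<Longrightarrow> \<bar>w $ j - c $ j\<bar> \<le> s) \<Longrightarrow> \<exists>x\<in>A. \<forall>j. j \<noteq> k \<longrightarrow> h x $ j = w $ j"
  shows "ennreal (unit_ball_vol (real (CARD('n) - 1)) * (s / 2) ^ (CARD('n) - 1))
           \<le> hausdorff_outer_measure (CARD('n) - 1) A"
proof -
  let ?n = "CARD('n) - 1"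
  let ?v = "unit_ball_vol (real ?n) / 4 ^ ?n"
  have weight: "ennreal (unit_ball_vol (real ?n) * (t / 2) ^ ?n) = ennreal ?v * ennreal ((2 * t) ^ ?n)"
    if "0 \<le> t" for t :: real
  proof -
    have "(2 * t) ^ ?n = (4 * (t / 2)) ^ ?n"
      by simp
    also have "\<dots> = 4 ^ ?n * (t / 2) ^ ?n"
      by (rule power_mult_distrib)
    finally have "unit_ball_vol (real ?n) * (t / 2) ^ ?n = ?v * (2 * t) ^ ?n"
      by simp
    also have "ennreal \<dots> = ennreal ?v * ennreal ((2 * t) ^ ?n)"
      using that by (intro ennreal_mult) auto
    finally show ?thesis .
  qed
  have "ennreal (unit_ball_vol (real ?n) * (s / 2) ^ ?n) \<le> (\<Sum>i. hausdorff_weight ?n (E i))"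
    if E: "E \<in> hausdorff_covers 1 A" for E
  proof -
    define p where "p i = (SOME x. x \<in> E i)" for i
    define B where "B i = (if E i = {} then {} else slab k (h (p i)) (diameter (E i)))" for i
    have p: "p i \<in> E i" if "E i \<noteq> {}" for i
      using that unfolding p_def by (simp add: some_in_eq)
    have bdd: "bounded (E i)" for i
      using E by (simp add: hausdorff_covers_def)
    have "slab k c s \<subseteq> (\<Union>i. B i)"
    proof
      fix w assume w: "w \<in> slab k c s"
      then obtain x where x: "x \<in> A" "\<And>j. j \<noteq> k \<Longrightarrow> h x $ j = w $ j"
        using cube[of w] by (auto simp: mem_slab_iff)
      from x(1) E obtain i where i: "x \<in> E i"
        by (auto simp: hausdorff_covers_def)
      have "\<bar>w $ j - h (p i) $ j\<bar> \<le> diameter (E i)" if "j \<noteq> k" for j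
        using h[OF that, of x "p i"] x(2)[OF that] i p[of i]
          diameter_bounded_bound[OF bdd[of i], of x "p i"] by fastforce
      then have "w \<in> B i"
        using i w by (auto simp: B_def mem_slab_iff)
      then show "w \<in> (\<Union>i. B i)" by blast
    qed
    then have "emeasure lborel (slab k c s) \<le> emeasure lborel (\<Union>i. B i)"
      by (rule emeasure_mono) (auto simp: B_def slab_def)
    also have "\<dots> \<le> (\<Sum>i. emeasure lborel (B i))"
      by (rule emeasure_subadditive_countably) (auto simp: B_def slab_def)
    finally have "ennreal ?v * emeasure lborel (slab k c s) \<le> ennreal ?v * (\<Sum>i. emeasure lborel (B i))"
      by (rule mult_left_mono) simp
    also have "\<dots> = (\<Sum>i. ennreal ?v * emeasure lborel (B i))"
      by simp
    also have "\<dots> = (\<Sum>i. hausdorff_weight ?n (E i))"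
    proof (rule arg_cong[where f = suminf], rule ext)
      fix i
      show "ennreal ?v * emeasure lborel (B i) = hausdorff_weight ?n (E i)"
        using weight[of "diameter (E i)"] emeasure_slab[of "diameter (E i)" k "h (p i)"]
          diameter_ge_0[OF bdd[of i]]
        by (simp add: B_def hausdorff_weight_def)
    qed
    finally show ?thesis
      by (simp only: weight[OF s] emeasure_slab[OF s])
  qed
  then have "ennreal (unit_ball_vol (real ?n) * (s / 2) ^ ?n) \<le> hausdorff_premeasure ?n 1 A"
    unfolding hausdorff_premeasure_def by (rule INF_greatest)
  also have "\<dots> \<le> hausdorff_outer_measure ?n A"
    by (rule hausdorff_premeasure_le_outer) simp
  finally show ?thesis .
qed

section \<open>Lower density of a Lipschitz boundary\<close>

text \<open>
  Points above the graph belong to the open set \<open>\<Omega>\<close>, points below it have by continuity of \<open>\<gamma>\<close>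
  a neighbourhood outside \<open>\<Omega>\<close>, and a point of the graph is a limit of the points above it.
\<close>

lemma frontier_epigraph:
  fixes \<Omega> :: "'a::euclidean_space set"
  assumes \<Omega>: "open \<Omega>" and e: "norm e = 1" and \<gamma>: "K-lipschitz_on {z. z \<bullet> e = 0} \<gamma>"
    and epi: "\<Omega> \<inter> ball p R = {x \<in> ball p R. \<gamma> (x - (x \<bullet> e) *\<^sub>R e) < x \<bullet> e}"
    and x: "x \<in> ball p R"
  shows "x \<in> frontier \<Omega> \<longleftrightarrow> \<gamma> (x - (x \<bullet> e) *\<^sub>R e) = x \<bullet> e"
proof -
  have ee: "e \<bullet> e = 1"
    using e by (simp only: norm_eq_1)
  define G where "G = (\<lambda>x. \<gamma> (x - (x \<bullet> e) *\<^sub>R e) - x \<bullet> e)"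
  have mem: "y \<in> \<Omega> \<longleftrightarrow> G y < 0" if "y \<in> ball p R" for y
    using eqset_imp_iff[OF epi, of y] that by (simp add: G_def)
  have "continuous_on UNIV (\<lambda>x. x - (x \<bullet> e) *\<^sub>R e)"
    by (intro continuous_intros)
  moreover have "range (\<lambda>x. x - (x \<bullet> e) *\<^sub>R e) \<subseteq> {z. z \<bullet> e = 0}"
    by (auto simp: inner_diff_left ee)
  ultimately have "continuous_on UNIV (\<lambda>x. \<gamma> (x - (x \<bullet> e) *\<^sub>R e))"
    by (rule continuous_on_compose2[OF lipschitz_on_continuous_on[OF \<gamma>]])
  then have G: "continuous_on UNIV G"
    unfolding G_def by (intro continuous_intros)
  show ?thesis
  proof
    assume fr: "x \<in> frontier \<Omega>"
    then have "x \<notin> \<Omega>"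
      using \<Omega> by (simp add: frontier_def interior_open)
    then have "0 \<le> G x"
      using mem[OF x] by simp
    moreover have "\<not> 0 < G x"
    proof
      assume "0 < G x"
      have "open ({y. 0 < G y} \<inter> ball p R)"
        by (intro open_Int open_Collect_less[OF _ G] open_ball) simp
      moreover have "({y. 0 < G y} \<inter> ball p R) \<inter> \<Omega> = {}"
        using mem by force
      ultimately have "({y. 0 < G y} \<inter> ball p R) \<inter> closure \<Omega> = {}"
        by (simp add: open_Int_closure_eq_empty)
      with \<open>0 < G x\<close> x fr show False
        by (auto simp: frontier_def)
    qed
    ultimately show "\<gamma> (x - (x \<bullet> e) *\<^sub>R e) = x \<bullet> e"
      by (simp add: G_def)
  next
    assume on: "\<gamma> (x - (x \<bullet> e) *\<^sub>R e) = x \<bullet> e"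
    then have "x \<notin> \<Omega>"
      using mem[OF x] by (simp add: G_def)
    moreover have "\<exists>y\<in>\<Omega>. dist x y < \<epsilon>" if "0 < \<epsilon>" for \<epsilon>
    proof -
      define t where "t = min (\<epsilon> / 2) ((R - dist p x) / 2)"
      have t: "0 < t" "t < \<epsilon>" "t < R - dist p x"
        using that x by (auto simp: t_def min_def)
      have d: "dist x (x + t *\<^sub>R e) = t"
        using t e by (simp add: dist_norm)
      then have "x + t *\<^sub>R e \<in> ball p R"
        using t dist_triangle[of p "x + t *\<^sub>R e" x] by simp
      moreover have "G (x + t *\<^sub>R e) < 0"
        using on t by (simp add: G_def inner_add_left ee algebra_simps)
      ultimately have "x + t *\<^sub>R e \<in> \<Omega>"
        by (simp only: mem)
      with d t(2) show ?thesis
        by (intro bexI[of _ "x + t *\<^sub>R e"]) simp_all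
    qed
    ultimately show "x \<in> frontier \<Omega>"
      unfolding frontier_straddle by (metis dist_self)
  qed
qed

text \<open>
  An orthogonal transformation \<open>f\<close> taking \<open>e\<close> to a coordinate axis makes the projection along \<open>e\<close>
  the omission of that coordinate. The point of the graph over \<open>z \<in> e\<^sup>\<bottom>\<close> differs from \<open>a\<close> by at most
  \<open>(1 + K)\<close> times the distance between \<open>z\<close> and the projection of \<open>a\<close>; this and the crude bound of the
  norm by the sum of the \<open>d\<close> coordinates determine the half side \<open>r / (2 d (1 + K))\<close> of the cube.
\<close>

lemma epigraph_lower_density:
  fixes \<Omega> :: "(real^'n::finite) set"
  assumes \<Omega>: "open \<Omega>" and e: "norm e = 1" and \<gamma>: "K-lipschitz_on {z. z \<bullet> e = 0} \<gamma>"
    and epi: "\<Omega> \<inter> ball p R = {x \<in> ball p R. \<gamma> (x - (x \<bullet> e) *\<^sub>R e) < x \<bullet> e}"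
    and a: "a \<in> frontier \<Omega>" and r: "0 < r" and sub: "ball a r \<subseteq> ball p R"
  shows "ennreal (unit_ball_vol (real (CARD('n) - 1)) *
             (r / (4 * real CARD('n) * (1 + K))) ^ (CARD('n) - 1))
           \<le> hausdorff_outer_measure (CARD('n) - 1) (frontier \<Omega> \<inter> ball a r)"
proof -
  let ?\<pi> = "\<lambda>x. x - (x \<bullet> e) *\<^sub>R e"
  have ee: "e \<bullet> e = 1"
    using e by (simp only: norm_eq_1)
  have K: "0 \<le> K"
    using \<gamma> by (rule lipschitz_on_nonneg)
  define s where "s = r / (2 * real CARD('n) * (1 + K))"
  have s: "0 \<le> s"
    using r K by (simp add: s_def)
  obtain k :: 'n where True by simp
  have "norm e = norm (axis k 1 :: real^'n)"
    using e by simp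
  then obtain f :: "real^'n \<Rightarrow> real^'n" where f: "orthogonal_transformation f" and fe: "f e = axis k 1"
    by (rule orthogonal_transformation_exists)
  have lin: "linear f"
    using f by (rule orthogonal_transformation_linear)
  have fnorm: "norm (f x) = norm x" for x
    using f by (simp add: orthogonal_transformation)
  have finner: "f x \<bullet> f y = x \<bullet> y" for x y
    using f by (simp add: orthogonal_transformation_def)
  have fk: "f x $ k = x \<bullet> e" for x
    using finner[of x e] by (simp add: fe inner_axis)
  have a_graph: "\<gamma> (?\<pi> a) = a \<bullet> e"
    using frontier_epigraph[OF \<Omega> e \<gamma> epi, of a] a r sub centre_in_ball by blast
  have "ennreal (unit_ball_vol (real (CARD('n) - 1)) * (s / 2) ^ (CARD('n) - 1))
           \<le> hausdorff_outer_measure (CARD('n) - 1) (frontier \<Omega> \<inter> ball a r)"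
  proof (rule hausdorff_outer_measure_ge_cube_projection[where h = f and k = k and c = "f a", OF s])
    fix x x' :: "real^'n" and j
    show "\<bar>f x $ j - f x' $ j\<bar> \<le> dist x x'"
      using component_le_norm_cart[of "f (x - x')" j]
      by (simp only: fnorm dist_norm linear_diff[OF lin, symmetric] vector_minus_component[symmetric])
  next
    fix w :: "real^'n" assume w: "\<And>j. j \<noteq> k \<Longrightarrow> \<bar>w $ j - f a $ j\<bar> \<le> s"
    obtain z where z: "f z = (\<chi> j. if j = k then 0 else w $ j)"
      using orthogonal_transformation_surj[OF f] by (metis surjD)
    have ze: "z \<bullet> e = 0"
      using fk[of z] z by simp
    have \<pi>e: "?\<pi> a \<bullet> e = 0"
      by (simp add: inner_diff_left ee)
    have "norm (z - ?\<pi> a) \<le> (\<Sum>j\<in>UNIV. \<bar>f (z - ?\<pi> a) $ j\<bar>)"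
      using norm_le_l1_cart[of "f (z - ?\<pi> a)"] by (simp add: fnorm)
    also have "\<dots> \<le> (\<Sum>j\<in>(UNIV::'n set). s)"
    proof (rule sum_mono)
      fix j
      show "\<bar>f (z - ?\<pi> a) $ j\<bar> \<le> s"
      proof (cases "j = k")
        case True
        then show ?thesis
          using s ze \<pi>e by (simp only: fk inner_diff_left[of z "?\<pi> a"])
      next
        case False
        then show ?thesis
          using w[OF False] by (simp add: linear_diff[OF lin] linear_scale[OF lin] z fe axis_def)
      qed
    qed
    also have "\<dots> = real CARD('n) * s"
      by simp
    finally have dz: "norm (z - ?\<pi> a) \<le> real CARD('n) * s" .
    define x where "x = z + \<gamma> z *\<^sub>R e"
    have xe: "x \<bullet> e = \<gamma> z" and x\<pi>: "?\<pi> x = z"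
      by (simp_all add: x_def inner_add_left ze ee)
    have xa: "x - a = (z - ?\<pi> a) + (\<gamma> z - \<gamma> (?\<pi> a)) *\<^sub>R e"
      unfolding a_graph by (simp add: x_def algebra_simps)
    have "norm (x - a) \<le> norm (z - ?\<pi> a) + \<bar>\<gamma> z - \<gamma> (?\<pi> a)\<bar>"
      unfolding xa by (rule order_trans[OF norm_triangle_ineq]) (simp add: e)
    also have "\<bar>\<gamma> z - \<gamma> (?\<pi> a)\<bar> \<le> K * norm (z - ?\<pi> a)"
      using lipschitz_onD[OF \<gamma>, of z "?\<pi> a"] ze \<pi>e by (simp add: dist_norm)
    also have "norm (z - ?\<pi> a) + K * norm (z - ?\<pi> a) = (1 + K) * norm (z - ?\<pi> a)"
      by (simp add: algebra_simps)
    also have "\<dots> \<le> (1 + K) * (real CARD('n) * s)"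
      using K by (intro mult_left_mono dz) simp
    also have "\<dots> = r / 2"
      using K by (simp add: s_def) (simp add: field_simps)
    finally have "norm (x - a) \<le> r / 2"
      by simp
    then have x_ball: "x \<in> ball a r"
      using r by (simp add: dist_norm norm_minus_commute)
    then have "x \<in> frontier \<Omega>"
      using frontier_epigraph[OF \<Omega> e \<gamma> epi, of x] sub xe x\<pi> by auto
    moreover have "\<forall>j. j \<noteq> k \<longrightarrow> f x $ j = w $ j"
      by (simp add: x_def linear_add[OF lin] linear_scale[OF lin] z fe axis_def)
    ultimately show "\<exists>x\<in>frontier \<Omega> \<inter> ball a r. \<forall>j. j \<noteq> k \<longrightarrow> f x $ j = w $ j"
      using x_ball by blast
  qed
  moreover have "s / 2 = r / (4 * real CARD('n) * (1 + K))"
    by (simp add: s_def)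
  ultimately show ?thesis
    by simp
qed

text \<open>
  Half the radius of a chart around \<open>p\<close> is kept in reserve, so that every boundary point within that
  half radius of \<open>p\<close> may use the same chart. Finitely many charts suffice by compactness, and the
  constants are minima over them.
\<close>

lemma lipschitz_boundary_lower_density:
  fixes \<Omega> :: "(real^'n::finite) set"
  assumes \<Omega>: "open \<Omega>" "bounded \<Omega>" "lipschitz_boundary \<Omega>"
  obtains \<kappa> r0 where "0 < \<kappa>" "0 < r0"
    "\<And>a r. \<lbrakk>a \<in> frontier \<Omega>; 0 < r; r \<le> r0\<rbrakk> \<Longrightarrow>
       ennreal (\<kappa> * r ^ (CARD('n) - 1)) \<le> hausdorff_outer_measure (CARD('n) - 1) (frontier \<Omega> \<inter> ball a r)"
proof -
  let ?n = "CARD('n) - 1"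
  let ?F = "frontier \<Omega>"
  have "\<exists>R \<kappa>. 0 < R \<and> 0 < \<kappa> \<and> (\<forall>a r. a \<in> ?F \<longrightarrow> 0 < r \<longrightarrow> ball a r \<subseteq> ball p R \<longrightarrow>
          ennreal (\<kappa> * r ^ ?n) \<le> hausdorff_outer_measure ?n (?F \<inter> ball a r))" if p: "p \<in> ?F" for p
  proof -
    from \<Omega>(3) p obtain R e \<gamma> K where R: "0 < R" and e: "norm e = 1"
      and \<gamma>: "K-lipschitz_on {z. z \<bullet> e = 0} \<gamma>"
      and epi: "\<Omega> \<inter> ball p R = {x \<in> ball p R. \<gamma> (x - (x \<bullet> e) *\<^sub>R e) < x \<bullet> e}"
      unfolding lipschitz_boundary_def by blast
    have K: "0 \<le> K"
      using \<gamma> by (rule lipschitz_on_nonneg)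
    define \<kappa> where "\<kappa> = unit_ball_vol (real ?n) * (1 / (4 * real CARD('n) * (1 + K))) ^ ?n"
    have "0 < \<kappa>"
      unfolding \<kappa>_def using K by (intro mult_pos_pos zero_less_power divide_pos_pos) auto
    moreover have "ennreal (\<kappa> * r ^ ?n) \<le> hausdorff_outer_measure ?n (?F \<inter> ball a r)"
      if "a \<in> ?F" "0 < r" "ball a r \<subseteq> ball p R" for a r
      using epigraph_lower_density[OF \<Omega>(1) e \<gamma> epi that]
      by (simp add: \<kappa>_def power_divide algebra_simps)
    ultimately show ?thesis
      using R by blast
  qed
  then obtain R \<kappa> where chart: "\<And>p. p \<in> ?F \<Longrightarrow> 0 < R p" "\<And>p. p \<in> ?F \<Longrightarrow> 0 < \<kappa> p"
    and dens: "\<And>p a r. \<lbrakk>p \<in> ?F; a \<in> ?F; 0 < r; ball a r \<subseteq> ball p (R p)\<rbrakk> \<Longrightarrow>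
          ennreal (\<kappa> p * r ^ ?n) \<le> hausdorff_outer_measure ?n (?F \<inter> ball a r)"
    by metis
  have "compact ?F"
    using \<Omega>(2) by (rule compact_frontier_bounded)
  have cover: "?F \<subseteq> (\<Union>p\<in>?F. ball p (R p / 2))"
    using chart(1) by force
  obtain S where S: "S \<subseteq> ?F" "finite S" "?F \<subseteq> (\<Union>p\<in>S. ball p (R p / 2))"
    by (rule compactE_image[OF \<open>compact ?F\<close> _ cover]) auto
  define k0 where "k0 = Min (insert 1 (\<kappa> ` S))"
  define r0 where "r0 = Min (insert 1 ((\<lambda>p. R p / 2) ` S))"
  show thesis
  proof (rule that[of k0 r0])
    show "0 < k0" "0 < r0"
      using S chart by (auto simp: k0_def r0_def subset_iff)
    fix a r assume a: "a \<in> ?F" and r: "0 < r" "r \<le> r0"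
    from a S(3) obtain p where p: "p \<in> S" "a \<in> ball p (R p / 2)" by blast
    have "k0 \<le> \<kappa> p"
      unfolding k0_def using p(1) S(2) by (intro Min_le) auto
    have "r0 \<le> R p / 2"
      unfolding r0_def using p(1) S(2) by (intro Min_le) auto
    have "ball a r \<subseteq> ball p (R p)"
    proof
      fix x assume "x \<in> ball a r"
      then show "x \<in> ball p (R p)"
        using p(2) r \<open>r0 \<le> R p / 2\<close> dist_triangle[of p x a] by simp
    qed
    then have "ennreal (\<kappa> p * r ^ ?n) \<le> hausdorff_outer_measure ?n (?F \<inter> ball a r)"
      using p(1) S(1) a r by (intro dens) auto
    moreover have "ennreal (k0 * r ^ ?n) \<le> ennreal (\<kappa> p * r ^ ?n)"
      using \<open>k0 \<le> \<kappa> p\<close> r by (intro ennreal_leI mult_right_mono) auto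
    ultimately show "ennreal (k0 * r ^ ?n) \<le> hausdorff_outer_measure ?n (?F \<inter> ball a r)"
      by (rule order_trans[rotated])
  qed
qed

section \<open>Energy of a self-contact\<close>

text \<open>
  Compactness bounds \<open>P\<close> from below on \<open>{\<tau>..\<tau> + 2}\<close>, and the growth of \<open>P\<close> beyond; without the
  growth \<open>P\<close> could decay to \<open>0\<close> at infinity.
\<close>

lemma positive_lower_bound:
  fixes P :: "real \<Rightarrow> real"
  assumes P: "continuous_on UNIV P" "\<And>t. t - 1 \<le> P t" "\<And>t. 0 < t \<Longrightarrow> 0 < P t" and \<tau>: "0 < \<tau>"
  obtains m where "0 < m" "\<And>t. \<tau> \<le> t \<Longrightarrow> m \<le> P t"
proof -
  have "continuous_on {\<tau>..\<tau> + 2} P"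
    using P(1) by (rule continuous_on_subset) simp
  then obtain t0 where t0: "t0 \<in> {\<tau>..\<tau> + 2}" "\<And>t. t \<in> {\<tau>..\<tau> + 2} \<Longrightarrow> P t0 \<le> P t"
    using continuous_attains_inf[of "{\<tau>..\<tau> + 2}" P] by auto
  show thesis
  proof (rule that[of "min 1 (P t0)"])
    show "0 < min 1 (P t0)"
      using t0(1) \<tau> P(3) by auto
    show "min 1 (P t0) \<le> P t" if "\<tau> \<le> t" for t
      using t0(2)[of t] P(2)[of t] that \<tau> by (cases "t \<le> \<tau> + 2") auto
  qed
qed

lemma set_nn_integral_ge_const:
  assumes "A \<in> sets M" "A \<subseteq> S" "\<And>x. x \<in> A \<Longrightarrow> c \<le> F x"
  shows "c * emeasure M A \<le> (\<integral>\<^sup>+x\<in>S. F x \<partial>M)"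
proof -
  have "c * emeasure M A = (\<integral>\<^sup>+x. c * indicator A x \<partial>M)"
    using assms(1) by (simp add: nn_integral_cmult_indicator)
  also have "\<dots> \<le> (\<integral>\<^sup>+x\<in>S. F x \<partial>M)"
    by (rule nn_integral_mono) (use assms in \<open>auto simp: indicator_def\<close>)
  finally show ?thesis .
qed

lemma boundary_energy_ge:
  fixes \<Omega> :: "(real^'d::finite) set" and y :: "real^'d \<Rightarrow> real^'d"
  assumes A: "A \<in> sets borel" "A \<subseteq> frontier \<Omega>" and B: "B \<in> sets borel" "B \<subseteq> frontier \<Omega>"
    and \<epsilon>: "0 < \<epsilon>" and m: "0 \<le> m"
    and P: "\<And>x x'. \<lbrakk>x \<in> A; x' \<in> B\<rbrakk> \<Longrightarrow> m \<le> P (g (norm (x' - x)) - g (norm (y x' - y x) / \<epsilon>))"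
    and HA: "ennreal \<mu> \<le> hausdorff_outer_measure (CARD('d) - 1) A"
    and HB: "ennreal \<mu> \<le> hausdorff_outer_measure (CARD('d) - 1) B"
    and \<mu>: "0 \<le> \<mu>"
  shows "ennreal (1 / \<epsilon> powr \<beta> * (1 / \<epsilon> ^ (CARD('d) - 1) * m * \<mu> * \<mu>)) \<le> boundary_energy P g \<beta> \<Omega> \<epsilon> y"
proof -
  let ?n = "CARD('d) - 1"
  let ?H = "hausdorff_measure ?n :: (real^'d) measure"
  let ?q = "1 / \<epsilon> ^ ?n * m"
  let ?f = "\<lambda>x x'. ennreal (1 / \<epsilon> ^ ?n * P (g (norm (x' - x)) - g (norm (y x' - y x) / \<epsilon>)))"
  have inner: "ennreal (?q * \<mu>) \<le> (\<integral>\<^sup>+x'\<in>frontier \<Omega>. ?f x x' \<partial>?H)" if x: "x \<in> A" for x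
  proof -
    have "ennreal (?q * \<mu>) = ennreal ?q * ennreal \<mu>"
      using \<epsilon> m \<mu> by (intro ennreal_mult) auto
    also have "\<dots> \<le> ennreal ?q * emeasure ?H B"
      using HB B by (intro mult_left_mono) (auto simp: emeasure_hausdorff_measure)
    also have "\<dots> \<le> (\<integral>\<^sup>+x'\<in>frontier \<Omega>. ?f x x' \<partial>?H)"
      using B P[OF x] \<epsilon> by (intro set_nn_integral_ge_const ennreal_leI mult_left_mono) auto
    finally show ?thesis .
  qed
  have "ennreal (1 / \<epsilon> powr \<beta> * (?q * \<mu> * \<mu>)) = ennreal (1 / \<epsilon> powr \<beta>) * (ennreal (?q * \<mu>) * ennreal \<mu>)"
    using \<epsilon> m \<mu> by (simp only: ennreal_mult[symmetric] zero_le_mult_iff zero_le_divide_iff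
        zero_le_power zero_le_one powr_ge_zero less_imp_le simp_thms)
  also have "\<dots> \<le> ennreal (1 / \<epsilon> powr \<beta>) * (ennreal (?q * \<mu>) * emeasure ?H A)"
    using HA A by (intro mult_left_mono) (auto simp: emeasure_hausdorff_measure)
  also have "\<dots> \<le> boundary_energy P g \<beta> \<Omega> \<epsilon> y"
    unfolding boundary_energy_def
    using A inner by (intro mult_left_mono set_nn_integral_ge_const) auto
  finally show ?thesis .
qed

text \<open>
  The bounds on \<open>r\<close> are met by \<open>r = \<rho> \<epsilon> / (8 L)\<close> when \<open>\<epsilon> \<le> 2 L\<close>. They give
  \<open>norm (x' - x) \<ge> \<rho> / 2\<close> by the triangle inequality through \<open>a\<close> and \<open>b\<close>, and
  \<open>norm (y x' - y x) \<le> \<rho> \<epsilon> / 4\<close> by the one through the common value \<open>y a = y b\<close>.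
\<close>

lemma self_contact_gap:
  fixes y :: "'a::real_normed_vector \<Rightarrow> 'b::real_normed_vector" and g :: "real \<Rightarrow> real"
  assumes g: "strict_mono_on {0..} g"
    and upper: "\<And>x1 x2. \<lbrakk>x1 \<in> S; x2 \<in> S; norm (x1 - x2) < \<rho>\<rbrakk> \<Longrightarrow> norm (y x1 - y x2) \<le> L * norm (x1 - x2)"
    and ab: "a \<in> S" "b \<in> S" "y a = y b" "\<rho> \<le> norm (a - b)"
    and \<epsilon>: "0 < \<epsilon>" and \<rho>: "0 < \<rho>" and L: "0 < L"
    and r: "r \<le> \<rho> / 4" "2 * L * r \<le> \<rho> / 4 * \<epsilon>"
    and x: "x \<in> S \<inter> ball a r" and x': "x' \<in> S \<inter> ball b r"
  shows "g (\<rho> / 2) - g (\<rho> / 4) \<le> g (norm (x' - x)) - g (norm (y x' - y x) / \<epsilon>)"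
proof -
  have xa: "norm (x - a) < r" and xb: "norm (x' - b) < r"
    using x x' by (auto simp: dist_norm norm_minus_commute)
  have "norm (a - b) \<le> norm (x - a) + (norm (x' - x) + norm (x' - b))"
    using norm_triangle_ineq4[of "(x' - x) + (x - a)" "x' - b"] norm_triangle_ineq[of "x' - x" "x - a"]
    by (simp add: norm_minus_commute)
  then have far: "\<rho> / 2 \<le> norm (x' - x)"
    using ab(4) xa xb r(1) by linarith
  have "norm (y x - y a) \<le> L * norm (x - a)" "norm (y x' - y b) \<le> L * norm (x' - b)"
    using upper[of x a] upper[of x' b] x x' ab(1,2) xa xb r(1) \<rho> by simp_all
  moreover have "L * norm (x - a) \<le> L * r" "L * norm (x' - b) \<le> L * r"
    using xa xb L by auto
  moreover have "norm (y x' - y x) \<le> norm (y x' - y b) + norm (y x - y a)"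
    using norm_triangle_ineq4[of "y x' - y b" "y x - y a"] ab(3) by simp
  ultimately have "norm (y x' - y x) \<le> \<rho> / 4 * \<epsilon>"
    using r(2) by linarith
  then have close: "norm (y x' - y x) / \<epsilon> \<le> \<rho> / 4"
    using \<epsilon> by (simp add: pos_divide_le_eq)
  have mono: "g s \<le> g t" if "0 \<le> s" "s \<le> t" for s t
    using strict_mono_on_leD[OF g, of s t] that by simp
  show ?thesis
    using mono[OF _ far] mono[OF _ close] \<rho> \<epsilon> by simp
qed

theorem corollary3:
  fixes \<Omega> :: "(real ^ 'd) set"
    and g P :: "real \<Rightarrow> real"
    and \<rho> l L C \<beta> :: real
  assumes "bounded_lipschitz_domain \<Omega>"
    and "continuous_on {0..} g"
    and "strict_mono_on {0..} g"
    and "g 0 = 0"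
    and "\<And>t. 0 \<le> t \<Longrightarrow> 0 \<le> g t"
    and "continuous_on UNIV P"
    and "\<And>t. 0 \<le> P t"
    and "\<And>t. max 0 (t - 1) \<le> P t"
    and "\<And>t. P t \<le> max 0 t"
    and "\<And>t. 0 < t \<Longrightarrow> 0 < P t"
    and "0 < \<rho>" and "0 < l" and "0 < L" and "0 < C"
    and "real (CARD('d) - 1) < \<beta>"
  shows "\<exists>\<epsilon>0 > 0. \<forall>\<epsilon> y. 0 < \<epsilon> \<and> \<epsilon> < \<epsilon>0 \<and>
           continuous_on (frontier \<Omega>) y \<and>
           (\<forall>x1 \<in> frontier \<Omega>. \<forall>x2 \<in> frontier \<Omega>. norm (x1 - x2) < \<rho> \<longrightarrow>
              l * norm (x1 - x2) \<le> norm (y x1 - y x2) \<and>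
              norm (y x1 - y x2) \<le> L * norm (x1 - x2)) \<and>
           boundary_energy P g \<beta> \<Omega> \<epsilon> y \<le> ennreal C
           \<longrightarrow> inj_on y (frontier \<Omega>)"
proof -
  let ?n = "CARD('d) - 1"
  note g = assms(3) and pos = assms(11,12,13,14) and \<beta> = assms(15)
  obtain \<kappa> r0 where \<kappa>: "0 < \<kappa>" and r0: "0 < r0"
    and dens: "\<And>a r. \<lbrakk>a \<in> frontier \<Omega>; 0 < r; r \<le> r0\<rbrakk> \<Longrightarrow>
       ennreal (\<kappa> * r ^ ?n) \<le> hausdorff_outer_measure ?n (frontier \<Omega> \<inter> ball a r)"
    using lipschitz_boundary_lower_density[of \<Omega>] assms(1)
    unfolding bounded_lipschitz_domain_def by blast
  define \<tau> where "\<tau> = g (\<rho> / 2) - g (\<rho> / 4)"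
  have "0 < \<tau>"
    using strict_mono_onD[OF g, of "\<rho> / 4" "\<rho> / 2"] pos by (simp add: \<tau>_def)
  moreover have "t - 1 \<le> P t" for t
    using assms(8)[of t] by simp
  ultimately obtain m where m: "0 < m" "\<And>t. \<tau> \<le> t \<Longrightarrow> m \<le> P t"
    using positive_lower_bound[of P \<tau>] assms(6,10) by blast
  define c where "c = \<rho> / (8 * L)"
  have c: "0 < c" "8 * L * c = \<rho>"
    using pos by (auto simp: c_def)
  define M where "M = m * (\<kappa> * c ^ ?n)\<^sup>2"
  have M: "0 < M"
    using m(1) \<kappa> c(1) by (simp add: M_def)
  define \<delta> where "\<delta> = \<beta> - real ?n"
  have \<delta>: "0 < \<delta>"
    using \<beta> by (simp add: \<delta>_def)
  \<comment> \<open>The first two bounds make \<open>c \<epsilon>\<close> at most \<open>r0\<close> and \<open>\<rho> / 4\<close>. The third is the value of \<open>\<epsilon>\<close> at which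
      the lower bound \<open>M / \<epsilon> powr \<delta>\<close> for the energy equals \<open>C\<close>.\<close>
  define \<epsilon>0 where "\<epsilon>0 = min (r0 / c) (min (2 * L) ((M / C) powr (1 / \<delta>)))"
  show ?thesis
  proof (intro exI[of _ \<epsilon>0] conjI allI impI)
    show "0 < \<epsilon>0"
      using r0 c(1) pos M by (simp add: \<epsilon>0_def)
    fix \<epsilon> y
    assume asm: "0 < \<epsilon> \<and> \<epsilon> < \<epsilon>0 \<and> continuous_on (frontier \<Omega>) y \<and>
           (\<forall>x1 \<in> frontier \<Omega>. \<forall>x2 \<in> frontier \<Omega>. norm (x1 - x2) < \<rho> \<longrightarrow>
              l * norm (x1 - x2) \<le> norm (y x1 - y x2) \<and>
              norm (y x1 - y x2) \<le> L * norm (x1 - x2)) \<and>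
           boundary_energy P g \<beta> \<Omega> \<epsilon> y \<le> ennreal C"
    then have \<epsilon>: "0 < \<epsilon>" "\<epsilon> < r0 / c" "\<epsilon> < 2 * L" "\<epsilon> < (M / C) powr (1 / \<delta>)"
      by (auto simp: \<epsilon>0_def)
    have lower: "l * norm (x1 - x2) \<le> norm (y x1 - y x2)"
      and upper: "norm (y x1 - y x2) \<le> L * norm (x1 - x2)"
      if "x1 \<in> frontier \<Omega>" "x2 \<in> frontier \<Omega>" "norm (x1 - x2) < \<rho>" for x1 x2
      using asm that by blast+
    have r: "0 < c * \<epsilon>" "c * \<epsilon> \<le> r0"
      using c(1) \<epsilon> by (auto simp: field_simps)
    have "c * \<epsilon> \<le> c * (2 * L)"
      using c(1) \<epsilon>(3) by (intro mult_left_mono) auto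
    then have r': "c * \<epsilon> \<le> \<rho> / 4"
      using c(2) by (simp add: algebra_simps)
    have r'': "2 * L * (c * \<epsilon>) \<le> \<rho> / 4 * \<epsilon>"
      by (simp add: c(2)[symmetric])
    show "inj_on y (frontier \<Omega>)"
    proof (rule inj_onI, rule ccontr)
      fix a b assume ab: "a \<in> frontier \<Omega>" "b \<in> frontier \<Omega>" "y a = y b" "a \<noteq> b"
      have far: "\<rho> \<le> norm (a - b)"
      proof (rule ccontr)
        assume "\<not> \<rho> \<le> norm (a - b)"
        then have "l * norm (a - b) \<le> norm (y a - y b)"
          using lower[OF ab(1,2)] by simp
        then show False
          using ab pos by (simp add: mult_le_0_iff)
      qed
      have "ennreal (1 / \<epsilon> powr \<beta> * (1 / \<epsilon> ^ ?n * m * (\<kappa> * (c * \<epsilon>) ^ ?n) * (\<kappa> * (c * \<epsilon>) ^ ?n)))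
              \<le> boundary_energy P g \<beta> \<Omega> \<epsilon> y"
      proof (rule boundary_energy_ge)
        fix x x' assume "x \<in> frontier \<Omega> \<inter> ball a (c * \<epsilon>)" "x' \<in> frontier \<Omega> \<inter> ball b (c * \<epsilon>)"
        from self_contact_gap[OF g upper ab(1-3) far \<epsilon>(1) pos(1) pos(3) r' r'' this]
        show "m \<le> P (g (norm (x' - x)) - g (norm (y x' - y x) / \<epsilon>))"
          by (intro m(2)) (simp add: \<tau>_def)
      qed (use ab dens r m(1) \<kappa> \<epsilon>(1) c(1) in \<open>auto intro: borel_closed\<close>)
      also have "\<dots> \<le> ennreal C"
        using asm by blast
      finally have "1 / \<epsilon> powr \<beta> * (1 / \<epsilon> ^ ?n * m * (\<kappa> * (c * \<epsilon>) ^ ?n) * (\<kappa> * (c * \<epsilon>) ^ ?n)) \<le> C"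
        using pos by (simp add: ennreal_le_iff)
      \<comment> \<open>The two balls contribute \<open>\<epsilon>\<^sup>2\<^sup>(\<^sup>d\<^sup>-\<^sup>1\<^sup>)\<close>, the kernel removes half of the exponent.\<close>
      also have "1 / \<epsilon> powr \<beta> * (1 / \<epsilon> ^ ?n * m * (\<kappa> * (c * \<epsilon>) ^ ?n) * (\<kappa> * (c * \<epsilon>) ^ ?n))
                   = M * (\<epsilon> ^ ?n / \<epsilon> powr \<beta>)"
        using \<epsilon>(1) by (simp add: M_def power_mult_distrib power2_eq_square field_simps)
      also have "\<epsilon> ^ ?n / \<epsilon> powr \<beta> = 1 / \<epsilon> powr \<delta>"
        unfolding \<delta>_def powr_diff powr_realpow[OF \<epsilon>(1)] by simp
      finally have "M / C \<le> \<epsilon> powr \<delta>"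
        using \<epsilon>(1) pos by (simp add: field_simps)
      moreover have "\<epsilon> powr \<delta> < ((M / C) powr (1 / \<delta>)) powr \<delta>"
        using \<epsilon> \<delta> by (intro powr_less_mono2) auto
      then have "\<epsilon> powr \<delta> < M / C"
        using \<delta> M pos by (simp add: powr_powr)
      ultimately show False by simp
    qed
  qed
qed

end
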